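(* Consider a distributed surface (D-LIS) system with $M$ circular surface units, each of radius $R_{\rm d}>0$, and $K$ users. Assume the $m$th unit is assigned to the $k$th user (with matched filtering for user $k$ at unit $m$). Then the achievable spectral efficiency of user $k$ is $$\mathsf{R}_k^{m}=\log_2\left(1+\frac{p_k\,\mathrm{PL}_{k,m}}{\frac{1}{\pi R_{\rm d}^2}\sigma^2+\sum_{k'\ne k}p_{k'}\,\mathrm{PL}_{k',m}\,\tilde{\rm B}(R_{\rm d},\kappa,\chi_{m,kk'})^2}\right),$$ where $\mathrm{PL}_{k,m}$ is the path loss between the $m$th unit and the $k$th user and $\chi_{m,kk'}$ is computed from the users' coordinates relative to the $m$th unit.
   Context: $j$ is the imaginary unit, $^*$ denotes complex conjugation, $J_1$ is the Bessel function of the first kind of order $1$. There are $M>K$ same-size units. Fix a unit $m$ and use Cartesian coordinates in which this unit is the disk $\mathcal{S}_m=\{(x,y,0):x^2+y^2\le R_{\rm d}^2\}$; in these coordinates user $k$ is at $(x_{k,m},y_{k,m},z_{k,m})$ with $z_{k,m}>0$. Let $d_{k,m}^c=\sqrt{x_{k,m}^2+y_{k,m}^2+z_{k,m}^2}$; $\kappa=2\pi/\lambda$ with $\lambda>0$ the wavelength; $\mathrm{PL}_{k,m}=\left(\frac{1}{2\kappa d_{k,m}^c}\right)^2$; $p_k$ the (nonnegative) transmit power of user $k$; $\sigma^2>0$ the noise variance; $\varphi_k\in[-\pi,\pi]$ a phase of user $k$. In the far-field (plane-wave) model the channel response of user $k$ at the point $(x,y,0)$ of unit $m$ is $$h_{k,m}(x,y)=\exp\!\Big(-j\Big(\kappa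 d_{k,m}^c+\kappa\,\frac{y_{k,m}\,y-x_{k,m}\,x}{d_{k,m}^c}+\varphi_k\Big)\Big),$$ and the effective channel at unit $m$ is $\Sigma^{m}_{kk'}=\iint_{x^2+y^2\le R_{\rm d}^2}h_{k,m}^*(x,y)h_{k',m}(x,y)\,dx\,dy$. The achievable spectral efficiency of user $k$ at unit $m$ with matched filtering is by definition $$\mathsf{R}_k^m=\log_2\left(1+\frac{p_k\,\mathrm{PL}_{k,m}\,(\Sigma^{m}_{kk})^2}{\Sigma^{m}_{kk}\sigma^2+\sum_{k'\ne k}p_{k'}\,\mathrm{PL}_{k',m}\,|\Sigma^{m}_{kk'}|^2}\right).$$ Put $\chi_{m,kk'}=\sqrt{\Big(\frac{x_{k,m}}{d_{k,m}^c}-\frac{x_{k',m}}{d_{k',m}^c}\Big)^2+\Big(\frac{y_{k,m}}{d_{k,m}^c}-\frac{y_{k',m}}{d_{k',m}^c}\Big)^2}$, ${\rm B}(R,\kappa,\chi)=2\pi R\,\frac{J_1(R\kappa\chi)}{\kappa\chi}$ for $\chi\ne0$ with ${\rm B}(R,\kappa,0)=\pi R^2$ (the limit), and $\tilde{\rm B}(R,\kappa,\chi)={\rm B}(R,\kappa,\chi)/{\rm B}(R,\kappa,0)$. *)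

theory Defs
  imports "HOL-Analysis.Analysis"
begin

definition bessel_J :: "nat \<Rightarrow> real \<Rightarrow> real" where
  "bessel_J n t = (\<Sum>i. (- 1) ^ i / (fact i * fact (i + n)) * (t / 2) ^ (2 * i + n))"

lemma summable_bessel_J:
  "summable (\<lambda>i. (- 1) ^ i / (fact i * fact (i + n)) * (t / 2 :: real) ^ (2 * i + n))"
proof (rule summable_comparison_test')
  show "summable (\<lambda>i. \<bar>t / 2\<bar> ^ n * (inverse (fact i) * (\<bar>t / 2\<bar>\<^sup>2) ^ i))"
    by (intro summable_mult summable_exp)
next
  fix i :: nat
  have "1 \<le> (fact (i + n) :: real)"
    by (rule fact_ge_1)
  then have "inverse (fact i * fact (i + n)) \<le> inverse (fact i :: real)"
    by (simp add: field_simps)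
  then have "inverse (fact i * fact (i + n)) * \<bar>t / 2\<bar> ^ (2 * i + n)
      \<le> inverse (fact i) * \<bar>t / 2\<bar> ^ (2 * i + n)"
    by (rule mult_right_mono) simp
  moreover have "norm ((- 1) ^ i / (fact i * fact (i + n)) * (t / 2) ^ (2 * i + n))
      = inverse (fact i * fact (i + n)) * \<bar>t / 2\<bar> ^ (2 * i + n)"
    by (simp only: real_norm_def abs_mult abs_divide power_abs abs_minus_cancel abs_one
        power_one abs_of_pos[OF fact_gt_zero] divide_inverse abs_inverse mult_1_left)
  moreover have "\<bar>t / 2\<bar> ^ (2 * i + n) = \<bar>t / 2\<bar> ^ n * (\<bar>t / 2\<bar>\<^sup>2) ^ i"
    unfolding power_add power_mult by (rule mult.commute)
  ultimately show "norm ((- 1) ^ i / (fact i * fact (i + n)) * (t / 2) ^ (2 * i + n))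
      \<le> \<bar>t / 2\<bar> ^ n * (inverse (fact i) * (\<bar>t / 2\<bar>\<^sup>2) ^ i)"
    by (simp only: mult.left_commute)
qed

text \<open>
  Users are indexed by \<open>{1..num_users S}\<close> and units by \<open>{1..num_units S}\<close>.
  \<open>x_coord S k m\<close>, \<open>y_coord S k m\<close>, \<open>z_coord S k m\<close> are the coordinates of user \<open>k\<close> in the
  Cartesian frame of unit \<open>m\<close>, in which that unit is the disk of radius \<open>radius S\<close> about the
  origin in the plane \<open>z = 0\<close>.
\<close>

record dlis =
  num_units :: nat
  num_users :: nat
  radius :: real
  wavelength :: real
  noise_variance :: real
  tx_power :: "nat \<Rightarrow> real"
  phase :: "nat \<Rightarrow> real"
  x_coord :: "nat \<Rightarrow> nat \<Rightarrow> real"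
  y_coord :: "nat \<Rightarrow> nat \<Rightarrow> real"
  z_coord :: "nat \<Rightarrow> nat \<Rightarrow> real"

definition wavenumber :: "dlis \<Rightarrow> real" where
  "wavenumber S = 2 * pi / wavelength S"

definition center_dist :: "dlis \<Rightarrow> nat \<Rightarrow> nat \<Rightarrow> real" where
  "center_dist S k m = sqrt ((x_coord S k m)\<^sup>2 + (y_coord S k m)\<^sup>2 + (z_coord S k m)\<^sup>2)"

definition path_loss :: "dlis \<Rightarrow> nat \<Rightarrow> nat \<Rightarrow> real" where
  "path_loss S k m = (1 / (2 * wavenumber S * center_dist S k m))\<^sup>2"

definition channel :: "dlis \<Rightarrow> nat \<Rightarrow> nat \<Rightarrow> real \<Rightarrow> real \<Rightarrow> complex" where
  "channel S k m x y =
     exp (- (\<i> * complex_of_real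
       (wavenumber S * center_dist S k m
        + wavenumber S * ((y_coord S k m * y - x_coord S k m * x) / center_dist S k m)
        + phase S k)))"

definition unit_surface :: "dlis \<Rightarrow> (real \<times> real) set" where
  "unit_surface S = {(x, y). x\<^sup>2 + y\<^sup>2 \<le> (radius S)\<^sup>2}"

definition effective_channel :: "dlis \<Rightarrow> nat \<Rightarrow> nat \<Rightarrow> nat \<Rightarrow> complex" where
  "effective_channel S m k k' =
     (LINT q:unit_surface S|lborel.
        cnj (channel S k m (fst q) (snd q)) * channel S k' m (fst q) (snd q))"

lemma effective_channel_self_real: "effective_channel S m k k \<in> \<real>"
proof -
  have "cnj w * w = complex_of_real ((cmod w)\<^sup>2)" for w
    by (metis complex_norm_square mult.commute)
  then have "effective_channel S m k k =
      complex_of_real (LINT q:unit_surface S|lborel. (cmod (channel S k m (fst q) (snd q)))\<^sup>2)"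
    by (simp only: effective_channel_def set_integral_complex_of_real)
  then show ?thesis
    by simp
qed

text \<open>
  The diagonal term \<open>effective_channel S m k k\<close> is real by the preceding lemma, so taking its real
  part below only converts its type.
\<close>

definition spectral_efficiency :: "dlis \<Rightarrow> nat \<Rightarrow> nat \<Rightarrow> real" where
  "spectral_efficiency S k m =
     log 2 (1 + tx_power S k * path_loss S k m * (Re (effective_channel S m k k))\<^sup>2 /
       (Re (effective_channel S m k k) * noise_variance S
        + (\<Sum>k'\<in>{1..num_users S} - {k}.
             tx_power S k' * path_loss S k' m * (cmod (effective_channel S m k k'))\<^sup>2)))"

definition chi :: "dlis \<Rightarrow> nat \<Rightarrow> nat \<Rightarrow> nat \<Rightarrow> real" where
  "chi S m k k' =
     sqrt ((x_coord S k m / center_dist S k m - x_coord S k' m / center_dist S k' m)\<^sup>2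
         + (y_coord S k m / center_dist S k m - y_coord S k' m / center_dist S k' m)\<^sup>2)"

definition B :: "real \<Rightarrow> real \<Rightarrow> real \<Rightarrow> real" where
  "B R \<kappa> c = (if c = 0 then pi * R\<^sup>2 else 2 * pi * R * (bessel_J 1 (R * \<kappa> * c) / (\<kappa> * c)))"

definition B_tilde :: "real \<Rightarrow> real \<Rightarrow> real \<Rightarrow> real" where
  "B_tilde R \<kappa> c = B R \<kappa> c / B R \<kappa> 0"

end

theory Submission
  imports Defs
begin

text \<open>
  Up to a unimodular factor, the product of two plane-wave responses is again a plane wave
  \<open>exp (i (p x + q y))\<close>, whose wave vector has length \<open>\<kappa> \<chi>\<close>. Slicing the disk perpendicularly to the
  wave vector reduces its integral to the cosine transform of the chord length
  \<open>2 sqrt (R\<^sup>2 - u\<^sup>2)\<close>. Expanding the cosine and integrating termwise, the even moments of the chord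
  length turn the series into that of \<open>J\<^sub>1\<close>. Since all effective channels then have modulus
  \<open>\<pi> R\<^sup>2\<close> times \<open>B_tilde\<close>, the factor \<open>(\<pi> R\<^sup>2)\<^sup>2\<close> cancels in the signal-to-interference ratio.
\<close>

section \<open>Integrals over a disk of functions that vary in one direction only\<close>

lemma compact_disk: "compact {(x, y). x\<^sup>2 + y\<^sup>2 \<le> (R::real)\<^sup>2}" (is "compact ?D")
proof -
  have "?D = cball 0 \<bar>R\<bar>"
    by (auto simp: norm_Pair real_sqrt_le_iff simp flip: real_sqrt_abs)
  then show ?thesis
    by simp
qed

lemma measure_disk:
  assumes "R \<ge> 0"
  shows "measure lborel {(x, y). x\<^sup>2 + y\<^sup>2 \<le> (R::real)\<^sup>2} = pi * R\<^sup>2" (is "measure _ ?D = _")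
proof -
  have "?D = cball 0 R"
    using assms by (auto simp: norm_Pair sqrt_le_D real_le_lsqrt)
  then show ?thesis
    using content_cball[OF assms, of "0 :: real \<times> real"] by (simp add: unit_ball_vol_2 power2_eq_square)
qed

text \<open>For fixed \<open>y\<close> the substitution \<open>u = a * x + b * y\<close> is affine
  in \<open>x\<close> and invertible because \<open>a\<close> is nonzero. Fubini then allows
  integrating over \<open>y\<close> first, where \<open>f u\<close> is constant and only the slice
  length remains.\<close>

lemma disk_slice_aux:
  fixes f :: "real \<Rightarrow> 'b::{banach, second_countable_topology}"
  assumes f: "continuous_on UNIV f" and ab: "a\<^sup>2 + b\<^sup>2 = 1" and a: "a \<noteq> 0"
  shows "(LINT q:{(x, y). x\<^sup>2 + y\<^sup>2 \<le> R\<^sup>2}|lborel. f (a * fst q + b * snd q)) =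
    (LINT u:{- \<bar>R\<bar>..\<bar>R\<bar>}|lborel. (2 * sqrt (R\<^sup>2 - u\<^sup>2)) *\<^sub>R f u)"
proof -
  define D where "D = {(x, y). x\<^sup>2 + y\<^sup>2 \<le> R\<^sup>2}"
  define T where "T = (\<lambda>(x, y). (a * x + b * y, y)) ` D"
  have T: "(u, y) \<in> T \<longleftrightarrow> ((u - b * y) / a, y) \<in> D" for u y
    using a by (force simp: T_def image_iff)
  text \<open>
    Shearing instead of rotating suffices: the slices of the sheared disk \<open>T\<close> at height \<open>u\<close> are
    intervals whose length is \<open>\<bar>a\<bar>\<close> times the chord length, and \<open>\<bar>a\<bar>\<close> is the Jacobian of the shear.
  \<close>
  have T_interval: "(u, y) \<in> T \<longleftrightarrow> \<bar>u\<bar> \<le> \<bar>R\<bar> \<and>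
      y \<in> {b * u - \<bar>a\<bar> * sqrt (R\<^sup>2 - u\<^sup>2)..b * u + \<bar>a\<bar> * sqrt (R\<^sup>2 - u\<^sup>2)}" for u y
  proof -
    have "(u, y) \<in> T \<longleftrightarrow> (u - b * y)\<^sup>2 + a\<^sup>2 * y\<^sup>2 \<le> a\<^sup>2 * R\<^sup>2"
      using a by (simp add: T D_def field_simps)
    \<comment> \<open>Completing the square in \<open>y\<close>, with leading coefficient
      \<open>a^2 + b^2 = 1\<close>, shows that the slice at \<open>u\<close> is centred at
      \<open>b * u\<close>.\<close>
    also have "(u - b * y)\<^sup>2 + a\<^sup>2 * y\<^sup>2 = (y - b * u)\<^sup>2 + a\<^sup>2 * u\<^sup>2"
      using ab by algebra
    also have "\<dots> \<le> a\<^sup>2 * R\<^sup>2 \<longleftrightarrow> (y - b * u)\<^sup>2 \<le> a\<^sup>2 * (R\<^sup>2 - u\<^sup>2)"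
      by (simp add: algebra_simps)
    also have "\<dots> \<longleftrightarrow> \<bar>u\<bar> \<le> \<bar>R\<bar> \<and> \<bar>y - b * u\<bar> \<le> \<bar>a\<bar> * sqrt (R\<^sup>2 - u\<^sup>2)"
    proof (cases "\<bar>u\<bar> \<le> \<bar>R\<bar>")
      case True
      have "(y - b * u)\<^sup>2 \<le> a\<^sup>2 * (R\<^sup>2 - u\<^sup>2) \<longleftrightarrow> sqrt ((y - b * u)\<^sup>2) \<le> sqrt (a\<^sup>2 * (R\<^sup>2 - u\<^sup>2))"
        by (simp only: real_sqrt_le_iff)
      with True show ?thesis
        by (simp add: real_sqrt_mult)
    next
      case False
      then have "R\<^sup>2 < u\<^sup>2"
        by (simp add: abs_le_square_iff)
      then have "a\<^sup>2 * (R\<^sup>2 - u\<^sup>2) < 0"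
        using a by (simp add: mult_less_0_iff)
      then have "\<not> (y - b * u)\<^sup>2 \<le> a\<^sup>2 * (R\<^sup>2 - u\<^sup>2)"
        by (smt (verit) zero_le_power2)
      with False show ?thesis
        by simp
    qed
    finally show ?thesis
      by auto
  qed
  have "compact D"
    unfolding D_def by (rule compact_disk)
  then have "compact T"
    unfolding T_def
    by (intro compact_continuous_image) (auto simp: case_prod_unfold intro!: continuous_intros)
  have fc: "continuous_on A (\<lambda>q. f (g q))" if "continuous_on A g" for A :: "(real \<times> real) set" and g
    by (rule continuous_on_compose2[OF f that]) simp
  have int_D: "integrable (lborel \<Otimes>\<^sub>M lborel)
      (\<lambda>(x, y). indicator D (x, y) *\<^sub>R f (a * x + b * y))"
    using borel_integrable_compact[OF \<open>compact D\<close> fc, of "\<lambda>q. a * fst q + b * snd q"]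
    by (simp add: lborel_prod case_prod_unfold continuous_on_add continuous_on_mult_left
        continuous_on_fst continuous_on_snd)
  have int_T: "integrable (lborel \<Otimes>\<^sub>M lborel) (\<lambda>(u, y). indicator T (u, y) *\<^sub>R f u)"
    using borel_integrable_compact[OF \<open>compact T\<close> fc, of fst]
    by (simp add: lborel_prod case_prod_unfold continuous_on_fst)
  have "(LINT q:D|lborel. f (a * fst q + b * snd q)) =
      integral\<^sup>L (lborel \<Otimes>\<^sub>M lborel)
        (\<lambda>(x, y). indicator D (x, y) *\<^sub>R f (a * x + b * y))"
    by (simp add: set_lebesgue_integral_def lborel_prod case_prod_unfold)
  also have "\<dots> = (LINT y|lborel. LINT x|lborel. indicator D (x, y) *\<^sub>R f (a * x + b * y))"
    by (rule lborel_pair.integral_snd[OF int_D, symmetric])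
  also have "\<dots> = (LINT y|lborel. (1 / \<bar>a\<bar>) *\<^sub>R (LINT u|lborel. indicator T (u, y) *\<^sub>R f u))"
  proof (rule Bochner_Integration.integral_cong[OF refl])
    fix y
    have "(LINT u|lborel. indicator T (u, y) *\<^sub>R f u) =
        \<bar>a\<bar> *\<^sub>R (LINT x|lborel. indicator T (b * y + a * x, y) *\<^sub>R f (b * y + a * x))"
      by (rule lborel_integral_real_affine[OF a])
    also have "(\<lambda>x. indicator T (b * y + a * x, y) *\<^sub>R f (b * y + a * x)) =
        (\<lambda>x. indicator D (x, y) *\<^sub>R f (a * x + b * y))"
      using a by (simp add: indicator_def T add.commute)
    finally show "(LINT x|lborel. indicator D (x, y) *\<^sub>R f (a * x + b * y)) =
        (1 / \<bar>a\<bar>) *\<^sub>R (LINT u|lborel. indicator T (u, y) *\<^sub>R f u)"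
      using a by simp
  qed
  also have "\<dots> = (1 / \<bar>a\<bar>) *\<^sub>R (LINT y|lborel. LINT u|lborel. indicator T (u, y) *\<^sub>R f u)"
    by simp
  \<comment> \<open>The exchange is legitimate since \<open>f\<close> is continuous and
    \<open>T\<close> compact.\<close>
  also have "\<dots> = (1 / \<bar>a\<bar>) *\<^sub>R (LINT u|lborel. LINT y|lborel. indicator T (u, y) *\<^sub>R f u)"
    using lborel_pair.Fubini_integral[OF int_T] by simp
  also have "\<dots> = (LINT u|lborel. (1 / \<bar>a\<bar>) *\<^sub>R (LINT y|lborel. indicator T (u, y) *\<^sub>R f u))"
    by simp
  also have "\<dots> = (LINT u:{- \<bar>R\<bar>..\<bar>R\<bar>}|lborel. (2 * sqrt (R\<^sup>2 - u\<^sup>2)) *\<^sub>R f u)"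
    unfolding set_lebesgue_integral_def
  proof (rule Bochner_Integration.integral_cong[OF refl])
    fix u
    show "(1 / \<bar>a\<bar>) *\<^sub>R (LINT y|lborel. indicator T (u, y) *\<^sub>R f u) =
        indicator {- \<bar>R\<bar>..\<bar>R\<bar>} u *\<^sub>R (2 * sqrt (R\<^sup>2 - u\<^sup>2)) *\<^sub>R f u"
    proof (cases "\<bar>u\<bar> \<le> \<bar>R\<bar>")
      case True
      then have "0 \<le> sqrt (R\<^sup>2 - u\<^sup>2)"
        by (simp add: abs_le_square_iff)
      define I where "I = {b * u - \<bar>a\<bar> * sqrt (R\<^sup>2 - u\<^sup>2)..b * u + \<bar>a\<bar> * sqrt (R\<^sup>2 - u\<^sup>2)}"
      have "(\<lambda>y. indicator T (u, y) *\<^sub>R f u) = (\<lambda>y. indicator I y *\<^sub>R f u)"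
        using True by (simp add: indicator_def T_interval I_def)
      moreover have "(LINT y|lborel. indicator I y *\<^sub>R f u) = measure lborel I *\<^sub>R f u"
        by (simp add: I_def)
      moreover have "measure lborel I = 2 * \<bar>a\<bar> * sqrt (R\<^sup>2 - u\<^sup>2)"
        using \<open>0 \<le> sqrt (R\<^sup>2 - u\<^sup>2)\<close> by (simp add: I_def)
      ultimately show ?thesis
        using True a by (simp add: abs_le_iff)
    next
      case False
      then have "u \<notin> {- \<bar>R\<bar>..\<bar>R\<bar>}"
        by auto
      then show ?thesis
        using False by (simp add: indicator_def T_interval)
    qed
  qed
  finally show ?thesis
    unfolding D_def .
qed

text \<open>The shear degenerates only for \<open>a = 0\<close>. Then \<open>b\<close> is nonzero,
  and since the disk is symmetric under swapping the coordinates, the roles of \<open>a\<close> and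
  \<open>b\<close> can be exchanged.\<close>

lemma disk_slice:
  fixes f :: "real \<Rightarrow> 'b::{banach, second_countable_topology}"
  assumes f: "continuous_on UNIV f" and ab: "a\<^sup>2 + b\<^sup>2 = 1"
  shows "(LINT q:{(x, y). x\<^sup>2 + y\<^sup>2 \<le> R\<^sup>2}|lborel. f (a * fst q + b * snd q)) =
    (LINT u:{- \<bar>R\<bar>..\<bar>R\<bar>}|lborel. (2 * sqrt (R\<^sup>2 - u\<^sup>2)) *\<^sub>R f u)"
proof (cases "a = 0")
  case True
  define D where "D = {(x, y). x\<^sup>2 + y\<^sup>2 \<le> R\<^sup>2}"
  have "compact D"
    unfolding D_def by (rule compact_disk)
  have D_swap: "(y, x) \<in> D \<longleftrightarrow> (x, y) \<in> D" for x y
    by (simp add: D_def add.commute)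
  have "continuous_on D (\<lambda>q. f (b * fst q + a * snd q))"
    by (rule continuous_on_compose2[OF f]) (auto intro!: continuous_intros)
  from borel_integrable_compact[OF \<open>compact D\<close> this]
  have "(\<lambda>q. indicator D q *\<^sub>R f (b * fst q + a * snd q)) \<in> borel_measurable (lborel \<Otimes>\<^sub>M lborel)"
    by (auto simp: lborel_prod)
  from lborel_pair.integral_product_swap[OF this]
  have "(LINT q:D|lborel. f (a * fst q + b * snd q)) = (LINT q:D|lborel. f (b * fst q + a * snd q))"
    by (simp add: set_lebesgue_integral_def lborel_prod case_prod_unfold indicator_def D_swap add.commute)
  also have "\<dots> = (LINT u:{- \<bar>R\<bar>..\<bar>R\<bar>}|lborel. (2 * sqrt (R\<^sup>2 - u\<^sup>2)) *\<^sub>R f u)"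
    unfolding D_def using ab True by (intro disk_slice_aux[OF f]) auto
  finally show ?thesis
    unfolding D_def .
qed (rule disk_slice_aux[OF f ab])

section \<open>Moments of the half chord and the Poisson integral of J_1\<close>

text \<open>These are the even moments of a semicircle: the factorial quotient is the Catalan number
  \<open>C_n\<close> over \<open>4^n\<close>. Writing \<open>M_n\<close> for the moment, the closed
  form follows from the recurrence
  \<open>(2 * n + 4) * M_(n+1) = (2 * n + 1) * R^2 * M_n\<close>.\<close>

lemma sqrt_moment:
  assumes R: "R \<ge> 0"
  shows "((\<lambda>u. u ^ (2 * n) * sqrt (R\<^sup>2 - u\<^sup>2)) has_integral
    pi / 2 * R ^ (2 * n + 2) * fact (2 * n) / (4 ^ n * fact n * fact (n + 1))) {- R..R}"
proof (induction n)
  case 0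
  let ?w = "\<lambda>u. 2 * sqrt (R\<^sup>2 - u\<^sup>2)"
  \<comment> \<open>Slicing the constant function 1 expresses the area of the disk as the integral
    of its chord lengths, so the moment of order zero is half that area.\<close>
  have "(LINT u:{- R..R}|lborel. ?w u) = (LINT q:{(x, y). x\<^sup>2 + y\<^sup>2 \<le> R\<^sup>2}|lborel. (1::real))"
    using disk_slice[of "\<lambda>_. 1::real" 1 0 R] R by simp
  also have "\<dots> = pi * R\<^sup>2"
    using measure_disk[OF R] by (simp add: set_lebesgue_integral_def)
  finally have "integral {- R..R} ?w = pi * R\<^sup>2"
    by (subst (asm) set_borel_integral_eq_integral(2))
      (auto intro!: borel_integrable_atLeastAtMost' continuous_intros)
  moreover have "?w integrable_on {- R..R}"
    by (intro integrable_continuous_interval continuous_intros)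
  ultimately have "(?w has_integral pi * R\<^sup>2) {- R..R}"
    by (metis integrable_integral)
  from has_integral_mult_right[OF this, of "1 / 2"] show ?case
    by (simp add: power2_eq_square)
next
  case (Suc n)
  define s where "s u = sqrt (R\<^sup>2 - u\<^sup>2)" for u
  \<comment> \<open>This is \<open>u^(2 * n + 1)\<close> times the power 3/2 of
    \<open>R^2 - u^2\<close>. It vanishes at both ends, so its derivative \<open>F'\<close>
    integrates to 0, which is the recurrence. The coefficient \<open>2 * n + 4\<close> is
    \<open>2 * n + 1\<close> plus 3, the 3 coming from the power 3/2.\<close>
  define F where "F u = u ^ (2 * n + 1) * ((R\<^sup>2 - u\<^sup>2) * s u)" for u
  define F' where "F' u = (2 * n + 1) * R\<^sup>2 * (u ^ (2 * n) * s u) - (2 * n + 4) * (u ^ (2 * Suc n) * s u)" for u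
  have "(F' has_integral (F R - F (- R))) {- R..R}"
  \<comment> \<open>The interior version avoids the endpoints, where the square root
    \<open>s\<close> is not differentiable.\<close>
  proof (rule fundamental_theorem_of_calculus_interior)
    show "continuous_on {- R..R} F"
      unfolding F_def s_def by (intro continuous_intros)
    fix u assume u: "u \<in> {- R<..<R}"
    then have pos: "R\<^sup>2 - u\<^sup>2 > 0"
      using abs_le_square_iff[of R u] R by auto
    then have s2: "(s u)\<^sup>2 = R\<^sup>2 - u\<^sup>2" and "s u > 0"
      by (simp_all add: s_def)
    have ds: "(s has_real_derivative - u / s u) (at u)"
      unfolding s_def using pos by (auto intro!: derivative_eq_intros simp: field_simps)
    have "(F has_real_derivative
        (2 * n + 1) * u ^ (2 * n) * ((R\<^sup>2 - u\<^sup>2) * s u)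
        + u ^ (2 * n + 1) * ((- 2 * u) * s u + (R\<^sup>2 - u\<^sup>2) * (- u / s u))) (at u)"
      unfolding F_def by (rule derivative_eq_intros ds refl)+ (simp add: algebra_simps)
    also have "(R\<^sup>2 - u\<^sup>2) * (- u / s u) = - u * s u"
      unfolding s2[symmetric] using \<open>s u > 0\<close> by (simp add: power2_eq_square)
    also have "(2 * n + 1) * u ^ (2 * n) * ((R\<^sup>2 - u\<^sup>2) * s u)
        + u ^ (2 * n + 1) * ((- 2 * u) * s u + - u * s u) = F' u"
      by (simp add: F'_def algebra_simps power2_eq_square)
    finally show "(F has_vector_derivative F' u) (at u)"
      by (simp add: has_real_derivative_iff_has_vector_derivative)
  qed (use R in simp)
  then have "(F' has_integral 0) {- R..R}"
    by (simp add: F_def s_def)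
  from has_integral_diff[OF has_integral_mult_right[OF Suc.IH, of "(2 * n + 1) * R\<^sup>2"] this]
  have "((\<lambda>u. (2 * n + 4) * (u ^ (2 * Suc n) * s u)) has_integral (2 * n + 1) * R\<^sup>2 *
      (pi / 2 * R ^ (2 * n + 2) * fact (2 * n) / (4 ^ n * fact n * fact (n + 1)))) {- R..R}"
    by (simp add: F'_def s_def)
  moreover define d where "d = real (2 * n + 4)"
  moreover have "d \<noteq> 0"
    by (simp add: d_def)
  ultimately have "((\<lambda>u. 1 / d * (d * (u ^ (2 * Suc n) * s u))) has_integral 1 / d * ((2 * n + 1) * R\<^sup>2 *
      (pi / 2 * R ^ (2 * n + 2) * fact (2 * n) / (4 ^ n * fact n * fact (n + 1))))) {- R..R}"
    by (intro has_integral_mult_right) simp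
  then have *: "((\<lambda>u. u ^ (2 * Suc n) * s u) has_integral 1 / d * ((2 * n + 1) * R\<^sup>2 *
      (pi / 2 * R ^ (2 * n + 2) * fact (2 * n) / (4 ^ n * fact n * fact (n + 1))))) {- R..R}"
    using \<open>d \<noteq> 0\<close> by simp
  have "1 / d * ((2 * n + 1) * R\<^sup>2 *
      (pi / 2 * R ^ (2 * n + 2) * fact (2 * n) / (4 ^ n * fact n * fact (n + 1)))) =
    pi / 2 * R ^ (2 * Suc n + 2) * fact (2 * Suc n) / (4 ^ Suc n * fact (Suc n) * fact (Suc n + 1))"
    unfolding d_def by (simp add: divide_simps) (simp add: algebra_simps power2_eq_square)
  with * show ?case
    unfolding s_def by metis
qed

text \<open>A rescaled form of Poisson's integral for J_1. The \<open>fact (2 * i)\<close> in the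
  cosine coefficient cancels against the one in the moment, leaving
  \<open>1 / (fact i * fact (i + 1))\<close> as in the Bessel series.\<close>

lemma sqrt_cos_integral:
  assumes R: "R \<ge> 0" and \<rho>: "\<rho> \<noteq> 0"
  shows "((\<lambda>u. 2 * sqrt (R\<^sup>2 - u\<^sup>2) * cos (\<rho> * u)) has_integral
    2 * pi * R * (bessel_J 1 (R * \<rho>) / \<rho>)) {- R..R}"
proof -
  define w where "w u = 2 * sqrt (R\<^sup>2 - u\<^sup>2)" for u
  define c where "c i u = w u * ((- 1) ^ i / fact (2 * i) * (\<rho> * u) ^ (2 * i))" for i u
  \<comment> \<open>The terms of the Bessel series at \<open>R * \<rho>\<close>, scaled by the
    target prefactor; each turns out to be the integral of \<open>c i\<close>.\<close>
  define v where "v i = 2 * pi * R / \<rho> * ((- 1) ^ i / (fact i * fact (i + 1)) * (R * \<rho> / 2) ^ (2 * i + 1))" for i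
  have four: "4 ^ i = (2 ^ i * 2 ^ i :: real)" for i
    by (simp flip: power_mult_distrib)
  have c_integral: "(c i has_integral v i) {- R..R}" for i
  proof -
    have "2 * ((- 1) ^ i / fact (2 * i) * \<rho> ^ (2 * i)) *
        (pi / 2 * R ^ (2 * i + 2) * fact (2 * i) / (4 ^ i * fact i * fact (i + 1))) = v i"
      using \<rho> by (simp add: v_def four field_simps power_mult power2_eq_square)
    with has_integral_mult_right[OF sqrt_moment[OF R, of i],
        of "2 * ((- 1) ^ i / fact (2 * i) * \<rho> ^ (2 * i))"]
    show ?thesis
      by (simp add: c_def[abs_def] w_def power_mult_distrib mult_ac)
  qed
  have "uniform_limit {- R..R} (\<lambda>n u. \<Sum>i<n. c i u) (\<lambda>u. \<Sum>i. c i u) sequentially"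
  proof (rule Weierstrass_m_test)
    \<comment> \<open>The majorant uses a chord length of at most \<open>2 * R\<close> and weakens
      \<open>1 / fact (2 * i)\<close> to \<open>1 / fact i\<close>, which makes it an exponential
      series in \<open>(\<bar>\<rho>\<bar> * R)^2\<close>.\<close>
    show "summable (\<lambda>i. 2 * R * (inverse (fact i) * ((\<bar>\<rho>\<bar> * R)\<^sup>2) ^ i))"
      by (intro summable_mult summable_exp)
    fix i u assume u: "u \<in> {- R..R}"
    then have "\<bar>u\<bar> \<le> R"
      by (simp add: abs_le_iff)
    then have "u\<^sup>2 \<le> R\<^sup>2"
      using abs_le_square_iff[of u R] R by simp
    then have w: "\<bar>w u\<bar> \<le> 2 * R"
      using R by (simp add: w_def real_le_lsqrt)
    have "inverse (fact (2 * i)) \<le> (inverse (fact i) :: real)"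
      by (intro le_imp_inverse_le fact_mono) simp_all
    moreover have "(\<bar>\<rho>\<bar> * \<bar>u\<bar>) ^ (2 * i) \<le> (\<bar>\<rho>\<bar> * R) ^ (2 * i)"
      by (intro power_mono mult_left_mono \<open>\<bar>u\<bar> \<le> R\<close>) simp_all
    ultimately have "inverse (fact (2 * i)) * (\<bar>\<rho>\<bar> * \<bar>u\<bar>) ^ (2 * i) \<le>
        inverse (fact i) * (\<bar>\<rho>\<bar> * R) ^ (2 * i)"
      by (intro mult_mono) simp_all
    with w have "\<bar>w u\<bar> * (inverse (fact (2 * i)) * (\<bar>\<rho>\<bar> * \<bar>u\<bar>) ^ (2 * i)) \<le>
        2 * R * (inverse (fact i) * (\<bar>\<rho>\<bar> * R) ^ (2 * i))"
      by (rule mult_mono) (use R in simp_all)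
    then show "norm (c i u) \<le> 2 * R * (inverse (fact i) * ((\<bar>\<rho>\<bar> * R)\<^sup>2) ^ i)"
      by (simp add: c_def abs_mult power_abs divide_inverse power_mult)
  qed
  moreover have "(\<Sum>i. c i u) = w u * cos (\<rho> * u)" for u
    unfolding c_def by (intro sums_unique[symmetric] sums_mult cos_paired)
  ultimately have "uniform_limit {- R..R} (\<lambda>n u. \<Sum>i<n. c i u) (\<lambda>u. w u * cos (\<rho> * u)) sequentially"
    by simp
  moreover have "continuous_on {- R..R} (\<lambda>u. \<Sum>i<n. c i u)" for n
    unfolding c_def w_def by (intro continuous_intros)
  ultimately obtain I L where IL: "\<And>n. ((\<lambda>u. \<Sum>i<n. c i u) has_integral I n) {- R..R}"
    "((\<lambda>u. w u * cos (\<rho> * u)) has_integral L) {- R..R}" "I \<longlonglongrightarrow> L"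
    by (rule uniform_limit_integral) auto
  have "I = (\<lambda>n. \<Sum>i<n. v i)"
    by (rule ext, rule has_integral_unique[OF IL(1)]) (intro has_integral_sum c_integral finite_lessThan)
  with IL(3) have "v sums L"
    by (simp add: sums_def)
  moreover have "v sums (2 * pi * R / \<rho> * bessel_J 1 (R * \<rho>))"
    unfolding v_def bessel_J_def by (intro sums_mult summable_sums summable_bessel_J)
  ultimately have "L = 2 * pi * R * (bessel_J 1 (R * \<rho>) / \<rho>)"
    by (simp add: sums_iff)
  with IL(2) show ?thesis
    by (simp add: w_def)
qed

section \<open>Plane waves on the disk and the effective channels\<close>

text \<open>After normalising the wave vector \<open>(p, q)\<close>, slicing leaves a
  one-dimensional Fourier integral of the chord length, which is even in \<open>u\<close>, so only
  the cosine part survives. A zero wave vector gives the area, matching the separate case in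
  \<open>B\<close>.\<close>

lemma disk_plane_wave:
  assumes R: "R \<ge> 0" and "\<kappa> > 0" "c \<ge> 0" and pq: "p\<^sup>2 + q\<^sup>2 = (\<kappa> * c)\<^sup>2"
  shows "(LINT z:{(x, y). x\<^sup>2 + y\<^sup>2 \<le> R\<^sup>2}|lborel. cis (p * fst z + q * snd z)) =
    complex_of_real (B R \<kappa> c)"
proof (cases "c = 0")
  case True
  with pq have "p = 0" "q = 0"
    by (simp_all add: sum_power2_eq_zero_iff)
  then show ?thesis
    using True set_integral_complex_of_real[of "lborel :: (real \<times> real) measure" _ "\<lambda>_. 1"] measure_disk[OF R]
    by (simp add: set_lebesgue_integral_def B_def)
next
  case False
  define \<rho> where "\<rho> = \<kappa> * c"
  have "\<rho> > 0"
    using assms False by (simp add: \<rho>_def)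
  define w where "w u = 2 * sqrt (R\<^sup>2 - u\<^sup>2)" for u
  have "(p / \<rho>)\<^sup>2 + (q / \<rho>)\<^sup>2 = 1"
    using pq \<open>\<rho> > 0\<close> by (simp add: power_divide flip: add_divide_distrib \<rho>_def)
  moreover have "continuous_on UNIV (\<lambda>u. cis (\<rho> * u))"
    by (intro continuous_intros)
  ultimately have "(LINT z:{(x, y). x\<^sup>2 + y\<^sup>2 \<le> R\<^sup>2}|lborel. cis (\<rho> * (p / \<rho> * fst z + q / \<rho> * snd z))) =
      (LINT u:{- R..R}|lborel. w u *\<^sub>R cis (\<rho> * u))"
    using R disk_slice[of "\<lambda>u. cis (\<rho> * u)" "p / \<rho>" "q / \<rho>" R] by (simp add: w_def)
  also have "\<dots> = integral {- R..R} (\<lambda>u. w u *\<^sub>R cis (\<rho> * u))"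
    unfolding w_def
    by (intro set_borel_integral_eq_integral borel_integrable_atLeastAtMost' continuous_intros)
  also have "\<dots> = complex_of_real (B R \<kappa> c)"
  proof (rule integral_unique)
    have "(\<lambda>u. w u * sin (\<rho> * u)) integrable_on {- R..R}"
      unfolding w_def by (intro integrable_continuous_interval continuous_intros)
    then obtain L where L: "((\<lambda>u. w u * sin (\<rho> * u)) has_integral L) {- R..R}"
      by blast
    \<comment> \<open>Reflecting \<open>u\<close> keeps the interval and the value \<open>L\<close>
      but negates the odd integrand, forcing \<open>L = 0\<close>.\<close>
    then have "((\<lambda>u. - (w u * sin (\<rho> * u))) has_integral L) {- R..R}"
      using has_integral_reflect_real[of "\<lambda>u. w u * sin (\<rho> * u)" L R "- R"] by (simp add: w_def)
    with has_integral_neg[OF L] have "- L = L"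
      by (rule has_integral_unique)
    then have "L = 0"
      by simp
    moreover have "((\<lambda>u. w u * cos (\<rho> * u)) has_integral B R \<kappa> c) {- R..R}"
    proof -
      have "B R \<kappa> c = 2 * pi * R * (bessel_J 1 (R * \<rho>) / \<rho>)"
        using False by (simp only: B_def \<rho>_def if_False mult.assoc)
      then show ?thesis
        using sqrt_cos_integral[OF R, of \<rho>] \<open>\<rho> > 0\<close> by (simp only: w_def)
    qed
    ultimately show "((\<lambda>u. w u *\<^sub>R cis (\<rho> * u)) has_integral complex_of_real (B R \<kappa> c)) {- R..R}"
      using L by (subst has_integral_componentwise_iff) (auto simp: Basis_complex_def inner_complex_def)
  qed
  finally show ?thesis
    using \<open>\<rho> > 0\<close> by (simp add: ring_distribs)
qed

text \<open>The centre distances and user phases do not depend on the point of the surface, so they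
  factor out as a unimodular constant. What remains is a plane wave.\<close>

lemma effective_channel_eq:
  assumes "radius S \<ge> 0" "wavelength S > 0"
  shows "effective_channel S m k k' =
    cis (wavenumber S * center_dist S k m + phase S k - wavenumber S * center_dist S k' m - phase S k')
    * complex_of_real (B (radius S) (wavenumber S) (chi S m k k'))"
proof -
  let ?\<kappa> = "wavenumber S"
  let ?\<theta> = "?\<kappa> * center_dist S k m + phase S k - ?\<kappa> * center_dist S k' m - phase S k'"
  \<comment> \<open>The differences in \<open>p\<close> and \<open>q\<close> run in opposite orders
    because \<open>x\<close> and \<open>y\<close> enter the response with opposite signs; the length
    of the wave vector depends only on their squares.\<close>
  define p where "p = ?\<kappa> * (x_coord S k' m / center_dist S k' m - x_coord S k m / center_dist S k m)"
  define q where "q = ?\<kappa> * (y_coord S k m / center_dist S k m - y_coord S k' m / center_dist S k' m)"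
  have "cnj (channel S k m x y) * channel S k' m x y = cis ?\<theta> * cis (p * x + q * y)" for x y
  proof -
    have ch: "channel S i m x y = cis (- (?\<kappa> * center_dist S i m
        + ?\<kappa> * ((y_coord S i m * y - x_coord S i m * x) / center_dist S i m) + phase S i))" for i
      by (simp only: channel_def cis_conv_exp of_real_minus mult_minus_right)
    show ?thesis
      unfolding ch cis_cnj cis_mult p_def q_def
      by (rule arg_cong[of _ _ cis]) (simp add: algebra_simps diff_divide_distrib)
  qed
  then have "effective_channel S m k k' =
      cis ?\<theta> * (LINT z:{(x, y). x\<^sup>2 + y\<^sup>2 \<le> (radius S)\<^sup>2}|lborel. cis (p * fst z + q * snd z))"
    by (simp add: effective_channel_def unit_surface_def)
  also have "(LINT z:{(x, y). x\<^sup>2 + y\<^sup>2 \<le> (radius S)\<^sup>2}|lborel. cis (p * fst z + q * snd z)) =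
      complex_of_real (B (radius S) ?\<kappa> (chi S m k k'))"
  proof (rule disk_plane_wave)
    show "p\<^sup>2 + q\<^sup>2 = (?\<kappa> * chi S m k k')\<^sup>2"
      by (simp add: p_def q_def chi_def power_mult_distrib distrib_left power2_commute)
  qed (use assms in \<open>simp_all add: wavenumber_def chi_def\<close>)
  finally show ?thesis .
qed

theorem proposition4:
  fixes S :: dlis and k m :: nat
  assumes "num_units S > num_users S"
    and "radius S > 0"
    and "wavelength S > 0"
    and "noise_variance S > 0"
    and "\<And>i. i \<in> {1..num_users S} \<Longrightarrow> tx_power S i \<ge> 0"
    and "\<And>i. i \<in> {1..num_users S} \<Longrightarrow> phase S i \<in> {- pi..pi}"
    and "\<And>i. i \<in> {1..num_users S} \<Longrightarrow> z_coord S i m > 0"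
    and "k \<in> {1..num_users S}"
    and "m \<in> {1..num_units S}"
  shows "spectral_efficiency S k m =
    log 2 (1 + tx_power S k * path_loss S k m /
      (1 / (pi * (radius S)\<^sup>2) * noise_variance S
       + (\<Sum>k'\<in>{1..num_users S} - {k}.
            tx_power S k' * path_loss S k' m
            * (B_tilde (radius S) (wavenumber S) (chi S m k k'))\<^sup>2)))"
proof -
  define A where "A = pi * (radius S)\<^sup>2"
  have "A > 0"
    using assms by (simp add: A_def)
  \<comment> \<open>For equal users both the phase difference and \<open>chi\<close> vanish, so the
    value is the area \<open>A\<close> itself.\<close>
  have self: "Re (effective_channel S m k k) = A"
    using assms by (simp add: effective_channel_eq chi_def B_def A_def)
  have cross: "(cmod (effective_channel S m k i))\<^sup>2 =
      A\<^sup>2 * (B_tilde (radius S) (wavenumber S) (chi S m k i))\<^sup>2" for i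
    using assms \<open>A > 0\<close>
    by (simp add: effective_channel_eq norm_mult B_tilde_def B_def[of _ _ 0] power_divide flip: A_def)
  let ?I = "\<Sum>i\<in>{1..num_users S} - {k}. tx_power S i * path_loss S i m
      * (B_tilde (radius S) (wavenumber S) (chi S m k i))\<^sup>2"
  \<comment> \<open>Extracting \<open>A^2\<close>, the square of the diagonal term in the numerator,
    turns the noise factor \<open>A\<close> into \<open>1 / A\<close> and the interference into
    normalised form.\<close>
  have "A * noise_variance S + (\<Sum>i\<in>{1..num_users S} - {k}.
      tx_power S i * path_loss S i m * (cmod (effective_channel S m k i))\<^sup>2) =
      (1 / A * noise_variance S + ?I) * A\<^sup>2"
    using \<open>A > 0\<close>
    by (simp add: cross ring_distribs sum_distrib_left sum_distrib_right
        power2_eq_square[of A] mult_ac)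
  then show ?thesis
    using \<open>A > 0\<close> by (simp add: spectral_efficiency_def self flip: A_def)
qed

end
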